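(* Let $S=(\mathbb N,\max)$, the semigroup of positive integers with product $(s,t)\mapsto\max(s,t)$, and let $E\subseteq\ell^\infty(S)$ be a predual for $\ell^1(S)$. Then $E=c_0(S)$.
   Context: $\mathbb N=\{1,2,3,\dots\}$. For a semigroup $S$ (discrete), $\ell^1(S)$ is the complex convolution Banach algebra with standard unit vectors $(\delta_s)_{s\in S}$ and product determined by $\delta_s\delta_t=\delta_{st}$ (here $\delta_s\delta_t=\delta_{\max(s,t)}$); its dual is identified with $\ell^\infty(S)$, with bimodule actions $(\delta_s\cdot f)(t)=f(ts)$ and $(f\cdot\delta_s)(t)=f(st)$. A predual of a Banach algebra $A$ is a norm-closed sub-bimodule $E\subseteq A^*$ which is a Banach space predual of $A$, i.e. the canonical map $A\to E^*$, $a\mapsto(\mu\mapsto\mu(a))$, is a linear isomorphism (bijective and bicontinuous, not necessarily isometric). (It is not assumed that $E$ is a subalgebra of $\ell^\infty(S)$.) $c_0(S)\subseteq\ell^\infty(S)$ is the space of functions vanishing at infinity on the discrete set $S$. *)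

theory Defs
  imports "HOL-Analysis.Analysis"
begin

section \<open>The Banach algebra of a discrete semigroup and its dual\<close>

text \<open>
  A discrete semigroup is given by a type \<open>'s\<close> and its product \<open>m :: 's \<Rightarrow> 's \<Rightarrow> 's\<close>.
  Elements of the Banach spaces below, including the functionals on a space of functions,
  are all complex-valued functions, with the pointwise vector space structure.
\<close>

definition l1 :: "('s \<Rightarrow> complex) set" where
  "l1 = {a. (\<lambda>s. norm (a s)) summable_on UNIV}"

definition l1_norm :: "('s \<Rightarrow> complex) \<Rightarrow> real" where
  "l1_norm a = (\<Sum>\<^sub>\<infinity>s. norm (a s))"

definition linf :: "('s \<Rightarrow> complex) set" where
  "linf = {f. bounded (range f)}"

definition linf_norm :: "('s \<Rightarrow> complex) \<Rightarrow> real" where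
  "linf_norm f = (SUP s. norm (f s))"

definition c0 :: "('s \<Rightarrow> complex) set" where
  "c0 = {f. (f \<longlongrightarrow> 0) cofinite}"

definition delta :: "'s \<Rightarrow> 's \<Rightarrow> complex" where
  "delta s = (\<lambda>t. if t = s then 1 else 0)"

definition conv :: "('s \<Rightarrow> 's \<Rightarrow> 's) \<Rightarrow> ('s \<Rightarrow> complex) \<Rightarrow> ('s \<Rightarrow> complex) \<Rightarrow> 's \<Rightarrow> complex" where
  "conv m a b = (\<lambda>u. \<Sum>\<^sub>\<infinity>(s, t)\<in>{(s, t). m s t = u}. a s * b t)"

text \<open>The pairing by which \<open>linf\<close> is identified with the dual of \<open>l1\<close>.\<close>

definition pairing :: "('s \<Rightarrow> complex) \<Rightarrow> ('s \<Rightarrow> complex) \<Rightarrow> complex" where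
  "pairing a f = (\<Sum>\<^sub>\<infinity>s. a s * f s)"

text \<open>
  The dual module actions: \<open>\<langle>b, a \<cdot> f\<rangle> = \<langle>b a, f\<rangle>\<close> and \<open>\<langle>b, f \<cdot> a\<rangle> = \<langle>a b, f\<rangle>\<close>. Under the
  identification above, the value of a functional at \<open>t\<close> is its pairing with \<open>delta t\<close>.
\<close>

definition left_act :: "('s \<Rightarrow> 's \<Rightarrow> 's) \<Rightarrow> ('s \<Rightarrow> complex) \<Rightarrow> ('s \<Rightarrow> complex) \<Rightarrow> 's \<Rightarrow> complex" where
  "left_act m a f = (\<lambda>t. pairing (conv m (delta t) a) f)"

definition right_act :: "('s \<Rightarrow> 's \<Rightarrow> 's) \<Rightarrow> ('s \<Rightarrow> complex) \<Rightarrow> ('s \<Rightarrow> complex) \<Rightarrow> 's \<Rightarrow> complex" where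
  "right_act m f a = (\<lambda>t. pairing (conv m a (delta t)) f)"

lemma infsum_delta:
  fixes h :: "'b \<Rightarrow> complex"
  assumes "\<And>y. y \<in> A \<Longrightarrow> y \<noteq> x \<Longrightarrow> h y = 0"
  shows "infsum h A = (if x \<in> A then h x else 0)"
proof -
  have "infsum h A = infsum h (A \<inter> {x})"
    by (rule infsum_cong_neutral) (use assms in auto)
  then show ?thesis by auto
qed

lemma pairing_delta: "pairing (delta t) f = f t"
  unfolding pairing_def by (subst infsum_delta[of _ t]) (auto simp: delta_def)

lemma conv_delta: "conv m (delta s) (delta t) = delta (m s t)"
proof
  fix u
  show "conv m (delta s) (delta t) u = delta (m s t) u"
    unfolding conv_def
    by (subst infsum_delta[of _ "(s, t)"]) (auto simp: delta_def split: if_splits)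
qed

lemma left_act_delta: "left_act m (delta s) f = (\<lambda>t. f (m t s))"
  by (simp add: left_act_def conv_delta pairing_delta)

lemma right_act_delta: "right_act m f (delta s) = (\<lambda>t. f (m s t))"
  by (simp add: right_act_def conv_delta pairing_delta)

section \<open>Preduals\<close>

text \<open>
  The norm topology on a linear space \<open>X\<close> of functions with norm \<open>N\<close>. The distance is cut off
  outside of \<open>X\<close> because \<^locale>\<open>Metric_space\<close> asks for non-negativity at all arguments, while
  \<open>N\<close> is only meaningful on \<open>X\<close>.
\<close>

definition norm_dist ::
    "('i \<Rightarrow> complex) set \<Rightarrow> (('i \<Rightarrow> complex) \<Rightarrow> real) \<Rightarrow> ('i \<Rightarrow> complex) \<Rightarrow> ('i \<Rightarrow> complex) \<Rightarrow> real" where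
  "norm_dist X N x y = (if x \<in> X \<and> y \<in> X then N (\<lambda>i. x i - y i) else 0)"

definition norm_topology ::
    "('i \<Rightarrow> complex) set \<Rightarrow> (('i \<Rightarrow> complex) \<Rightarrow> real) \<Rightarrow> ('i \<Rightarrow> complex) topology" where
  "norm_topology X N = Metric_space.mtopology X (norm_dist X N)"

definition lin_subspace :: "('i \<Rightarrow> complex) set \<Rightarrow> bool" where
  "lin_subspace X \<longleftrightarrow>
     (\<lambda>i. 0) \<in> X \<and>
     (\<forall>x\<in>X. \<forall>y\<in>X. (\<lambda>i. x i + y i) \<in> X) \<and>
     (\<forall>c. \<forall>x\<in>X. (\<lambda>i. c * x i) \<in> X)"

text \<open>
  The Banach dual of a subspace \<open>E\<close> of \<open>linf\<close>. A functional on \<open>E\<close> is represented by the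
  function that vanishes off \<open>E\<close>, so that equality of functionals is equality of functions.
\<close>

definition dual :: "('s \<Rightarrow> complex) set \<Rightarrow> (('s \<Rightarrow> complex) \<Rightarrow> complex) set" where
  "dual E = {\<phi>.
     (\<forall>f\<in>E. \<forall>g\<in>E. \<phi> (\<lambda>s. f s + g s) = \<phi> f + \<phi> g) \<and>
     (\<forall>c. \<forall>f\<in>E. \<phi> (\<lambda>s. c * f s) = c * \<phi> f) \<and>
     (\<exists>C. \<forall>f\<in>E. norm (\<phi> f) \<le> C * linf_norm f) \<and>
     (\<forall>f. f \<notin> E \<longrightarrow> \<phi> f = 0)}"

definition dual_norm :: "('s \<Rightarrow> complex) set \<Rightarrow> (('s \<Rightarrow> complex) \<Rightarrow> complex) \<Rightarrow> real" where
  "dual_norm E \<phi> = (SUP f\<in>{f \<in> E. linf_norm f \<le> 1}. norm (\<phi> f))"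

definition canonical_map :: "('s \<Rightarrow> complex) set \<Rightarrow> ('s \<Rightarrow> complex) \<Rightarrow> ('s \<Rightarrow> complex) \<Rightarrow> complex" where
  "canonical_map E a = (\<lambda>f. if f \<in> E then pairing a f else 0)"

text \<open>
  The canonical map is linear, so it is a linear isomorphism (bijective and bicontinuous) iff
  it is a homeomorphism for the norm topologies. It need not be isometric.
\<close>

definition predual :: "('s \<Rightarrow> 's \<Rightarrow> 's) \<Rightarrow> ('s \<Rightarrow> complex) set \<Rightarrow> bool" where
  "predual m E \<longleftrightarrow>
     E \<subseteq> linf \<and>
     lin_subspace E \<and>
     closedin (norm_topology linf linf_norm) E \<and>
     (\<forall>a\<in>l1. \<forall>f\<in>E. left_act m a f \<in> E \<and> right_act m f a \<in> E) \<and>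
     homeomorphic_map (norm_topology l1 l1_norm) (norm_topology (dual E) (dual_norm E))
       (canonical_map E)"

lemma Metric_space_norm_dist:
  assumes X: "lin_subspace X"
    and nn: "\<And>x. x \<in> X \<Longrightarrow> 0 \<le> N x"
    and z: "\<And>x. x \<in> X \<Longrightarrow> N x = 0 \<longleftrightarrow> x = (\<lambda>i. 0)"
    and uminus: "\<And>x. x \<in> X \<Longrightarrow> N (\<lambda>i. - x i) = N x"
    and tri: "\<And>x y. x \<in> X \<Longrightarrow> y \<in> X \<Longrightarrow> N (\<lambda>i. x i + y i) \<le> N x + N y"
  shows "Metric_space X (norm_dist X N)"
proof
  have diff: "(\<lambda>i. x i - y i) \<in> X" if "x \<in> X" "y \<in> X" for x y
  proof -
    have "(\<lambda>i. (-1) * y i) \<in> X"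
      using X that unfolding lin_subspace_def by blast
    moreover have "\<forall>u\<in>X. \<forall>v\<in>X. (\<lambda>i. u i + v i) \<in> X"
      using X unfolding lin_subspace_def by blast
    ultimately have "(\<lambda>i. x i + (-1) * y i) \<in> X"
      using that(1) by fast
    then show ?thesis by simp
  qed
  show "0 \<le> norm_dist X N x y" for x y
    using nn diff by (auto simp: norm_dist_def)
  show "norm_dist X N x y = norm_dist X N y x" for x y
    using uminus[OF diff, of x y] by (auto simp: norm_dist_def)
  show "norm_dist X N x y = 0 \<longleftrightarrow> x = y" if "x \<in> X" "y \<in> X" for x y
    using z[OF diff, OF that] that by (auto simp: norm_dist_def fun_eq_iff)
  show "norm_dist X N x u \<le> norm_dist X N x y + norm_dist X N y u"
    if "x \<in> X" "y \<in> X" "u \<in> X" for x y u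
    using tri[OF diff diff, of x y y u] that by (simp add: norm_dist_def)
qed

lemma lin_subspace_l1: "lin_subspace l1"
proof -
  have "(\<lambda>i. x i + y i) \<in> l1" if "x \<in> l1" "y \<in> l1" for x y :: "'s \<Rightarrow> complex"
  proof -
    have "(\<lambda>s. norm (x s) + norm (y s)) summable_on UNIV"
      using that by (intro summable_on_add) (simp_all add: l1_def)
    then have "(\<lambda>s. norm (x s + y s)) summable_on UNIV"
      by (rule summable_on_comparison_test) (simp_all add: norm_triangle_ineq)
    then show ?thesis by (simp add: l1_def)
  qed
  moreover have "(\<lambda>i. c * x i) \<in> l1" if "x \<in> l1" for c and x :: "'s \<Rightarrow> complex"
    using that summable_on_cmult_right[of "\<lambda>s. norm (x s)" UNIV "norm c"]
    by (simp add: l1_def norm_mult)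
  ultimately show ?thesis
    unfolding lin_subspace_def by (intro conjI ballI allI) (simp_all add: l1_def)
qed

lemma Metric_space_l1: "Metric_space l1 (norm_dist l1 (l1_norm :: ('s \<Rightarrow> complex) \<Rightarrow> real))"
proof (rule Metric_space_norm_dist[OF lin_subspace_l1])
  fix x y :: "'s \<Rightarrow> complex"
  assume x: "x \<in> l1"
  show "0 \<le> l1_norm x"
    by (simp add: l1_norm_def infsum_nonneg)
  show "l1_norm x = 0 \<longleftrightarrow> x = (\<lambda>i. 0)"
  proof
    assume "l1_norm x = 0"
    then have "norm (x s) = 0" for s
      using nonneg_infsum_le_0D[of "\<lambda>s. norm (x s)" UNIV s] x
      by (auto simp: l1_norm_def l1_def)
    then show "x = (\<lambda>i. 0)" by auto
  qed (simp add: l1_norm_def)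
  show "l1_norm (\<lambda>i. - x i) = l1_norm x"
    by (simp add: l1_norm_def)
  assume y: "y \<in> l1"
  have "l1_norm (\<lambda>i. x i + y i) \<le> (\<Sum>\<^sub>\<infinity>s. norm (x s) + norm (y s))"
    unfolding l1_norm_def
  proof (rule infsum_mono)
    have "(\<lambda>i. x i + y i) \<in> l1"
      using x y lin_subspace_l1 unfolding lin_subspace_def by blast
    then show "(\<lambda>s. norm (x s + y s)) summable_on UNIV"
      by (simp add: l1_def)
    show "(\<lambda>s. norm (x s) + norm (y s)) summable_on UNIV"
      using x y by (intro summable_on_add) (simp_all add: l1_def)
  qed (rule norm_triangle_ineq)
  also have "\<dots> = l1_norm x + l1_norm y"
    using x y unfolding l1_norm_def l1_def by (intro infsum_add) auto
  finally show "l1_norm (\<lambda>i. x i + y i) \<le> l1_norm x + l1_norm y" .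
qed

lemma linf_norm_ge: "f \<in> linf \<Longrightarrow> norm (f s) \<le> linf_norm f"
  unfolding linf_norm_def linf_def
  by (rule cSUP_upper) (auto simp: bounded_iff bdd_above_def)

lemma linf_norm_le: "(\<And>s. norm (f s) \<le> C) \<Longrightarrow> linf_norm f \<le> C"
  unfolding linf_norm_def by (rule cSUP_least) auto

lemma linf_norm_nonneg: "f \<in> linf \<Longrightarrow> 0 \<le> linf_norm f"
  using linf_norm_ge[of f undefined] norm_ge_zero order_trans by blast

lemma lin_subspace_linf: "lin_subspace linf"
proof -
  have "(\<lambda>i. x i + y i) \<in> linf" if "x \<in> linf" "y \<in> linf" for x y :: "'s \<Rightarrow> complex"
    unfolding linf_def bounded_iff
    using linf_norm_ge[OF that(1)] linf_norm_ge[OF that(2)]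
    by (auto intro!: exI[of _ "linf_norm x + linf_norm y"] norm_triangle_le add_mono)
  moreover have "(\<lambda>i. c * x i) \<in> linf" if "x \<in> linf" for c and x :: "'s \<Rightarrow> complex"
    unfolding linf_def bounded_iff
    using linf_norm_ge[OF that]
    by (auto intro!: exI[of _ "norm c * linf_norm x"] mult_left_mono simp: norm_mult)
  ultimately show ?thesis
    unfolding lin_subspace_def by (intro conjI ballI allI) (simp_all add: linf_def)
qed

lemma Metric_space_linf: "Metric_space linf (norm_dist linf (linf_norm :: ('s \<Rightarrow> complex) \<Rightarrow> real))"
proof (rule Metric_space_norm_dist[OF lin_subspace_linf])
  fix x y :: "'s \<Rightarrow> complex"
  assume x: "x \<in> linf"
  show "0 \<le> linf_norm x"
    by (rule linf_norm_nonneg[OF x])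
  show "linf_norm x = 0 \<longleftrightarrow> x = (\<lambda>i. 0)"
    using linf_norm_ge[OF x] by (auto simp: fun_eq_iff) (simp add: linf_norm_def)
  show "linf_norm (\<lambda>i. - x i) = linf_norm x"
    by (simp add: linf_norm_def)
  assume y: "y \<in> linf"
  show "linf_norm (\<lambda>i. x i + y i) \<le> linf_norm x + linf_norm y"
    by (intro linf_norm_le norm_triangle_le add_mono linf_norm_ge x y)
qed

lemma lin_subspace_dual: "lin_subspace (dual E)"
proof -
  have add: "(\<lambda>f. \<phi> f + \<psi> f) \<in> dual E" if \<phi>: "\<phi> \<in> dual E" and \<psi>: "\<psi> \<in> dual E" for \<phi> \<psi>
  proof -
    obtain C D where "\<forall>f\<in>E. norm (\<phi> f) \<le> C * linf_norm f" "\<forall>f\<in>E. norm (\<psi> f) \<le> D * linf_norm f"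
      using \<phi> \<psi> unfolding dual_def by blast
    then have "\<forall>f\<in>E. norm (\<phi> f + \<psi> f) \<le> (C + D) * linf_norm f"
      by (auto simp: distrib_right intro!: norm_triangle_le add_mono)
    then have "\<exists>C. \<forall>f\<in>E. norm (\<phi> f + \<psi> f) \<le> C * linf_norm f" by blast
    then show ?thesis
      using \<phi> \<psi> by (simp add: dual_def distrib_left)
  qed
  have scale: "(\<lambda>f. c * \<phi> f) \<in> dual E" if \<phi>: "\<phi> \<in> dual E" for c \<phi>
  proof -
    obtain C where "\<forall>f\<in>E. norm (\<phi> f) \<le> C * linf_norm f"
      using \<phi> unfolding dual_def by blast
    then have "\<forall>f\<in>E. norm (c * \<phi> f) \<le> (norm c * C) * linf_norm f"
      by (auto simp: norm_mult mult.assoc intro!: mult_left_mono)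
    then have "\<exists>C. \<forall>f\<in>E. norm (c * \<phi> f) \<le> C * linf_norm f" by blast
    then show ?thesis
      using \<phi> by (simp add: dual_def distrib_left)
  qed
  have "(\<lambda>f. 0) \<in> dual E"
    unfolding dual_def by (auto intro!: exI[of _ 0])
  with add scale show ?thesis
    unfolding lin_subspace_def by blast
qed

lemma dual_norm_ge:
  assumes E: "E \<subseteq> linf" and \<phi>: "\<phi> \<in> dual E" and f: "f \<in> E" "linf_norm f \<le> 1"
  shows "norm (\<phi> f) \<le> dual_norm E \<phi>"
proof -
  obtain C where C: "\<And>f. f \<in> E \<Longrightarrow> norm (\<phi> f) \<le> C * linf_norm f"
    using \<phi> unfolding dual_def by blast
  have "norm (\<phi> g) \<le> \<bar>C\<bar>" if g: "g \<in> E" "linf_norm g \<le> 1" for g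
  proof -
    have "0 \<le> linf_norm g" using linf_norm_nonneg E g by blast
    then have "C * linf_norm g \<le> \<bar>C\<bar> * linf_norm g" "\<bar>C\<bar> * linf_norm g \<le> \<bar>C\<bar> * 1"
      using g by (intro mult_right_mono mult_left_mono; simp)+
    then show ?thesis using C[OF g(1)] by simp
  qed
  then have "bdd_above ((\<lambda>f. norm (\<phi> f)) ` {f \<in> E. linf_norm f \<le> 1})"
    by (auto simp: bdd_above_def)
  then show ?thesis
    unfolding dual_norm_def using f by (intro cSUP_upper) auto
qed

lemma Metric_space_dual:
  assumes E: "E \<subseteq> linf" "lin_subspace E"
  shows "Metric_space (dual E) (norm_dist (dual E) (dual_norm E))"
proof (rule Metric_space_norm_dist[OF lin_subspace_dual])
  have zE: "(\<lambda>s. 0) \<in> E" and scE: "\<And>c f. f \<in> E \<Longrightarrow> (\<lambda>s. c * f s) \<in> E"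
    using E(2) unfolding lin_subspace_def by blast+
  have z1: "linf_norm (\<lambda>s. 0) \<le> 1"
    by (simp add: linf_norm_def)
  fix \<phi> \<psi>
  assume \<phi>: "\<phi> \<in> dual E"
  note ge = dual_norm_ge[OF E(1) \<phi>]
  show "0 \<le> dual_norm E \<phi>"
    using ge[OF zE z1] norm_ge_zero order_trans by blast
  show "dual_norm E \<phi> = 0 \<longleftrightarrow> \<phi> = (\<lambda>f. 0)"
  proof
    assume 0: "dual_norm E \<phi> = 0"
    show "\<phi> = (\<lambda>f. 0)"
    proof
      fix f
      show "\<phi> f = 0"
      proof (cases "f \<in> E")
        case True
        define r where "r = 1 / (1 + linf_norm f)"
        have fl: "f \<in> linf" and nn: "0 \<le> linf_norm f"
          using E(1) True linf_norm_nonneg by blast+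
        then have r: "r > 0" by (simp add: r_def)
        have "linf_norm (\<lambda>s. of_real r * f s) \<le> 1"
        proof (rule linf_norm_le)
          fix s
          have "norm (f s) \<le> 1 + linf_norm f" using linf_norm_ge[OF fl, of s] by simp
          then have "r * norm (f s) \<le> 1"
            using nn by (simp add: r_def divide_simps)
          then show "norm (of_real r * f s) \<le> 1"
            using r by (simp add: norm_mult)
        qed
        then have "norm (\<phi> (\<lambda>s. of_real r * f s)) \<le> 0"
          using ge[OF scE[OF True]] 0 by metis
        moreover have "\<phi> (\<lambda>s. of_real r * f s) = of_real r * \<phi> f"
          using \<phi> True unfolding dual_def by blast
        ultimately show ?thesis using r by simp
      next
        case False
        then show ?thesis using \<phi> unfolding dual_def by blast
      qed
    qed
  next
    assume "\<phi> = (\<lambda>f. 0)"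
    moreover have "{f \<in> E. linf_norm f \<le> 1} \<noteq> {}"
      using zE z1 by blast
    ultimately show "dual_norm E \<phi> = 0"
      by (simp add: dual_norm_def)
  qed
  show "dual_norm E (\<lambda>f. - \<phi> f) = dual_norm E \<phi>"
    by (simp add: dual_norm_def)
  assume \<psi>: "\<psi> \<in> dual E"
  show "dual_norm E (\<lambda>f. \<phi> f + \<psi> f) \<le> dual_norm E \<phi> + dual_norm E \<psi>"
    unfolding dual_norm_def[of E "\<lambda>f. \<phi> f + \<psi> f"]
  proof (rule cSUP_least)
    show "{f \<in> E. linf_norm f \<le> 1} \<noteq> {}"
      using zE z1 by blast
  next
    fix f assume f: "f \<in> {f \<in> E. linf_norm f \<le> 1}"
    then show "norm (\<phi> f + \<psi> f) \<le> dual_norm E \<phi> + dual_norm E \<psi>"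
      using ge dual_norm_ge[OF E(1) \<psi>] by (intro norm_triangle_le add_mono) auto
  qed
qed

section \<open>The positive integers\<close>

typedef posint = "{n :: nat. 1 \<le> n}"
  morphisms nat_of_posint posint_of_nat
  by auto

instantiation posint :: linorder
begin

definition less_eq_posint :: "posint \<Rightarrow> posint \<Rightarrow> bool" where
  "x \<le> y \<longleftrightarrow> nat_of_posint x \<le> nat_of_posint y"

definition less_posint :: "posint \<Rightarrow> posint \<Rightarrow> bool" where
  "x < y \<longleftrightarrow> nat_of_posint x < nat_of_posint y"

instance
  by standard (auto simp: less_eq_posint_def less_posint_def nat_of_posint_inject)

end

end

theory Submission
  imports Defs
begin

text \<open>
  If \<open>f \<in> E\<close> separates \<open>s\<close> from its successor \<open>t\<close>, then \<open>\<delta>\<^sub>s \<cdot> f - \<delta>\<^sub>t \<cdot> f\<close> is a non-zero multiple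
  of the indicator function of \<open>{..s}\<close>; such \<open>f\<close> exist because \<open>E\<close> separates the points of \<open>l1\<close>.
  Hence \<open>E\<close> contains all unit vectors, and so \<open>c0\<close>. Conversely, if \<open>f \<in> E\<close> does not vanish at
  infinity, then the limit along a suitable filter on which all elements of \<open>E\<close> converge is a
  functional on \<open>E\<close> that is non-zero at \<open>f\<close> but kills all unit vectors. Such a functional
  cannot be represented by an element of \<open>l1\<close>.
\<close>

text \<open>Tychonoff takes the place of an ultrafilter: the points \<open>\<lambda>i. h i s\<close>
  all lie in the compact product of the \<open>K i\<close>, so their image filter has a cluster
  point \<open>L\<close>, and \<open>F\<close> can be refined so that all coordinates converge to
  those of \<open>L\<close> at once.\<close>

lemma finer_filter_all_convergent:
  fixes h :: "'i \<Rightarrow> 's \<Rightarrow> 'b::topological_space"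
  assumes F: "F \<noteq> bot" and K: "\<And>i. compact (K i)" and hK: "\<And>i s. h i s \<in> K i"
  obtains G L where "G \<le> F" "G \<noteq> bot" "\<And>i. (h i \<longlongrightarrow> L i) G"
proof -
  define ev where "ev = (\<lambda>s i. h i s)"
  have "compact (Pi\<^sub>E UNIV K)"
    using K by (simp flip: compactin_euclidean_iff euclidean_product_topology add: compactin_PiE)
  moreover have "filtermap ev F \<noteq> bot"
    using F by (simp add: filtermap_bot_iff)
  moreover have "eventually (\<lambda>x. x \<in> Pi\<^sub>E UNIV K) (filtermap ev F)"
    using hK by (simp add: eventually_filtermap ev_def PiE_iff)
  ultimately have "\<exists>L\<in>Pi\<^sub>E UNIV K. inf (nhds L) (filtermap ev F) \<noteq> bot"
    by (rule compact_filter[THEN iffD1, rule_format])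
  then obtain L where L: "inf (nhds L) (filtermap ev F) \<noteq> bot" by (rule bexE)
  \<comment> \<open>\<open>G\<close> adds to \<open>F\<close> the preimages under \<open>ev\<close>
    of the neighbourhoods of \<open>L\<close>. It is proper because a cluster point has no
    neighbourhood that \<open>ev\<close> eventually avoids along \<open>F\<close>.\<close>
  define G where "G = inf (filtercomap ev (nhds L)) F"
  have "G \<noteq> bot"
  proof
    assume "G = bot"
    then obtain Q R where "eventually Q (nhds L)" and R: "eventually R F"
      and disj: "\<And>s. Q (ev s) \<Longrightarrow> \<not> R s"
      unfolding G_def trivial_limit_def eventually_inf eventually_filtercomap by blast
    moreover have "eventually (\<lambda>x. \<not> Q x) (filtermap ev F)"
      unfolding eventually_filtermap using R by (rule eventually_mono) (use disj in blast)
    ultimately show False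
      using L unfolding trivial_limit_def eventually_inf by blast
  qed
  moreover have "(h i \<longlongrightarrow> L i) G" for i
  proof -
    have "(ev \<longlongrightarrow> L) G"
      unfolding G_def by (meson filterlim_filtercomap filterlim_mono inf_le1 order_refl)
    then have "((\<lambda>s. ev s i) \<longlongrightarrow> L i) G"
      using continuous_on_tendsto_compose[OF continuous_on_product_coordinates, of ev L G i] by simp
    then show ?thesis by (simp add: ev_def)
  qed
  moreover have "G \<le> F"
    by (simp add: G_def)
  ultimately show ?thesis using that by blast
qed

lemma delta_in_l1: "delta s \<in> l1"
  unfolding l1_def mem_Collect_eq
  by (rule finite_nonzero_values_imp_summable_on) (auto simp: delta_def intro: finite_subset[of _ "{s}"])

lemma topspace_norm_topology_l1: "topspace (norm_topology l1 l1_norm) = l1"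
  by (simp add: norm_topology_def Metric_space.topspace_mtopology Metric_space_l1)

lemma lin_subspace_diff:
  assumes "lin_subspace X" "f \<in> X" "g \<in> X"
  shows "(\<lambda>i. f i - g i) \<in> X"
proof -
  have add: "\<forall>x\<in>X. \<forall>y\<in>X. (\<lambda>i. x i + y i) \<in> X" and scale: "\<forall>c. \<forall>x\<in>X. (\<lambda>i. c * x i) \<in> X"
    using assms(1) unfolding lin_subspace_def by blast+
  have "(\<lambda>i. (-1) * g i) \<in> X"
    using scale assms(3) by blast
  then have "(\<lambda>i. f i + (-1) * g i) \<in> X"
    using add assms(2) by fast
  then show ?thesis by simp
qed

lemma lin_subspace_scale: "lin_subspace X \<Longrightarrow> f \<in> X \<Longrightarrow> (\<lambda>i. c * f i) \<in> X"
  unfolding lin_subspace_def by blast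

lemma lin_subspace_sum:
  assumes "lin_subspace X" "finite A" "\<And>a. a \<in> A \<Longrightarrow> f a \<in> X"
  shows "(\<lambda>i. \<Sum>a\<in>A. f a i) \<in> X"
  using assms(2,3)
proof (induction A rule: finite_induct)
  case empty
  then show ?case using assms(1) by (simp add: lin_subspace_def)
next
  case (insert x A)
  then have "f x \<in> X" "(\<lambda>i. \<Sum>a\<in>A. f a i) \<in> X" by auto
  moreover have "\<forall>x\<in>X. \<forall>y\<in>X. (\<lambda>i. x i + y i) \<in> X"
    using assms(1) unfolding lin_subspace_def by blast
  ultimately have "(\<lambda>i. f x i + (\<Sum>a\<in>A. f a i)) \<in> X" by fast
  then show ?case using insert by simp
qed

lemma c0_finite_ge:
  assumes "f \<in> c0" "e > 0"
  shows "finite {s. norm (f s) \<ge> e}"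
proof -
  have "eventually (\<lambda>s. dist (f s) 0 < e) cofinite"
    using assms unfolding c0_def by (auto dest: tendstoD)
  then show ?thesis by (simp add: eventually_cofinite not_less)
qed

lemma c0_subset_linf: "c0 \<subseteq> linf"
proof
  fix f :: "'s \<Rightarrow> complex" assume f: "f \<in> c0"
  define A where "A = {s. norm (f s) \<ge> 1}"
  have "finite A" using c0_finite_ge[OF f] by (simp add: A_def)
  have "norm (f s) \<le> 1 + (\<Sum>a\<in>A. norm (f a))" for s
  proof (cases "s \<in> A")
    case True
    then have "norm (f s) \<le> (\<Sum>a\<in>A. norm (f a))"
      using \<open>finite A\<close> by (intro member_le_sum) auto
    then show ?thesis by simp
  next
    case False
    then have "norm (f s) \<le> 1" by (simp add: A_def)
    then show ?thesis by (simp add: add_increasing2 sum_nonneg)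
  qed
  then show "f \<in> linf" unfolding linf_def bounded_iff by auto
qed

text \<open>Cutting \<open>f\<close> down to the finite set where it is large leaves a finite
  combination of unit vectors that is uniformly close to \<open>f\<close>, so \<open>f\<close> has
  no ball around it that misses \<open>E\<close>.\<close>

lemma closed_subspace_with_deltas_contains_c0:
  assumes lin: "lin_subspace E" and cl: "closedin (norm_topology linf linf_norm) E"
    and deltas: "\<And>s. delta s \<in> E"
  shows "c0 \<subseteq> E"
proof (rule subsetI, rule ccontr)
  interpret Metric_space linf "norm_dist linf (linf_norm :: ('a \<Rightarrow> complex) \<Rightarrow> real)"
    by (rule Metric_space_linf)
  fix f assume f: "f \<in> c0" and nE: "f \<notin> E"
  have fl: "f \<in> linf" using f c0_subset_linf by blast
  obtain r where r: "r > 0" "disjnt E (mball f r)" and El: "E \<subseteq> linf"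
    using cl fl nE unfolding norm_topology_def closedin_metric by blast
  \<comment> \<open>The threshold is half the radius because the supremum of the remainder is
    bounded only non-strictly, while the ball is open.\<close>
  define A where "A = {s. norm (f s) \<ge> r / 2}"
  define g where "g = (\<lambda>s. \<Sum>a\<in>A. f a * delta a s)"
  have finA: "finite A"
    unfolding A_def by (rule c0_finite_ge[OF f]) (use r in simp)
  have gE: "g \<in> E"
    unfolding g_def by (intro lin_subspace_sum lin_subspace_scale lin finA deltas)
  have g: "g s = (if s \<in> A then f s else 0)" for s
    using finA by (simp add: g_def delta_def if_distrib cong: if_cong)
  have "linf_norm (\<lambda>s. f s - g s) \<le> r / 2"
    using r by (intro linf_norm_le) (auto simp: g A_def)
  then have "g \<in> mball f r"
    using r fl gE El by (auto simp: norm_dist_def)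
  then show False using r gE by (auto simp: disjnt_iff)
qed

text \<open>Surjectivity onto the dual makes every functional on \<open>E\<close> determined by its
  values at the unit vectors, which rules out a non-zero limit functional at infinity.\<close>

lemma subspace_with_l1_dual_subset_c0:
  assumes El: "E \<subseteq> linf" and lin: "lin_subspace E" and deltas: "\<And>s. delta s \<in> E"
    and surj: "dual E \<subseteq> canonical_map E ` l1"
  shows "E \<subseteq> c0"
proof (rule subsetI, rule ccontr)
  fix f assume fE: "f \<in> E" and "f \<notin> c0"
  then obtain e where e: "e > 0" "\<not> eventually (\<lambda>s. dist (f s) 0 < e) cofinite"
    unfolding c0_def tendsto_iff by auto
  define A where "A = {s. norm (f s) \<ge> e}"
  \<comment> \<open>Along any filter finer than \<open>F\<close>, finitely supported functions tend
    to 0, while \<open>f\<close> keeps modulus at least \<open>e\<close>.\<close>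
  define F where "F = inf cofinite (principal A)"
  have "infinite A"
    using e(2) by (simp add: eventually_cofinite A_def not_less)
  then have "F \<noteq> bot"
    by (auto simp: F_def trivial_limit_def eventually_inf_principal eventually_cofinite)
  \<comment> \<open>The cutoff allows all functions as indices: those outside \<open>E\<close> get a
    ball of radius 0, and the limit functional vanishes off \<open>E\<close>, as \<open>dual\<close>
    demands.\<close>
  define h where "h = (\<lambda>g s. if g \<in> E then g s else 0)"
  have "h g s \<in> cball 0 (if g \<in> E then linf_norm g else 0)" for g s
    using linf_norm_ge[OF subsetD[OF El], of g s] by (simp add: h_def)
  then obtain G \<phi> where GF: "G \<le> F" and G: "G \<noteq> bot" and lim: "\<And>g. (h g \<longlongrightarrow> \<phi> g) G"
    using finer_filter_all_convergent[OF \<open>F \<noteq> bot\<close>, of "\<lambda>g. cball 0 (if g \<in> E then linf_norm g else 0)" h]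
      compact_cball by metis
  have lim': "(g \<longlongrightarrow> \<phi> g) G" if "g \<in> E" for g
    using lim[of g] that by (simp add: h_def)
  have unique': "\<phi> g = l" if "g \<in> E" "(g \<longlongrightarrow> l) G" for g l
    using tendsto_unique[OF G lim'] that by blast
  have "\<phi> \<in> dual E"
    unfolding dual_def mem_Collect_eq
  proof (intro conjI ballI allI impI exI[of _ 1])
    fix g k assume g: "g \<in> E" and k: "k \<in> E"
    have "(\<lambda>s. g s + k s) \<in> E"
      using lin g k unfolding lin_subspace_def by blast
    then show "\<phi> (\<lambda>s. g s + k s) = \<phi> g + \<phi> k"
      by (rule unique') (intro tendsto_add lim' g k)
  next
    fix c g assume g: "g \<in> E"
    then show "\<phi> (\<lambda>s. c * g s) = c * \<phi> g"
      by (intro unique' lin_subspace_scale lin tendsto_mult tendsto_const lim')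
  next
    fix g assume g: "g \<in> E"
    then have "g \<in> linf" using El by blast
    then have "norm (\<phi> g) \<le> linf_norm g"
      by (intro Lim_norm_ubound[OF G lim'[OF g]] always_eventually allI linf_norm_ge)
    then show "norm (\<phi> g) \<le> 1 * linf_norm g" by simp
  next
    fix g assume "g \<notin> E"
    then show "\<phi> g = 0"
      using lim[of g] G by (simp add: h_def tendsto_const_iff)
  qed
  then obtain a where a: "\<phi> = canonical_map E a"
    using surj by blast
  \<comment> \<open>The value of \<open>\<phi>\<close> at \<open>delta s\<close> is 0 as a limit at
    infinity, and it is \<open>a s\<close> as a pairing.\<close>
  have "a s = 0" for s
  proof -
    have "eventually (\<lambda>t. t \<noteq> s) cofinite"
      by (simp add: eventually_cofinite)
    then have "eventually (\<lambda>t. delta s t = 0) G"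
      using GF unfolding F_def le_filter_def eventually_inf_principal
      by (auto simp: delta_def elim!: eventually_mono)
    then have "\<phi> (delta s) = 0"
      by (intro unique' deltas tendsto_eventually)
    moreover have "\<phi> (delta s) = a s"
      using deltas[of s] unfolding a canonical_map_def pairing_def
      by (subst infsum_delta[of _ s]) (auto simp: delta_def)
    ultimately show ?thesis by simp
  qed
  then have "\<phi> f = 0"
    by (simp add: a canonical_map_def pairing_def)
  moreover have "norm (\<phi> f) \<ge> e"
  proof (rule tendsto_lowerbound[OF tendsto_norm[OF lim'[OF fE]] _ G])
    show "eventually (\<lambda>s. e \<le> norm (f s)) G"
      using GF unfolding F_def le_filter_def eventually_inf_principal by (simp add: A_def)
  qed
  ultimately show False using e by simp
qed

text \<open>Here \<open>t\<close> is the immediate successor of \<open>s\<close>, so the actions of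
  \<open>delta s\<close> and \<open>delta t\<close> on \<open>f\<close> differ only on the points up
  to \<open>s\<close>, and there by a constant.\<close>

lemma indicator_in_bimodule:
  fixes E :: "('s::linorder \<Rightarrow> complex) set"
  assumes lin: "lin_subspace E" and module: "\<And>a f. a \<in> l1 \<Longrightarrow> f \<in> E \<Longrightarrow> left_act max a f \<in> E"
    and f: "f \<in> E" "f s \<noteq> f t" and "s < t" and succ: "\<And>u. u \<le> s \<or> t \<le> u"
  shows "(\<lambda>u. if u \<le> s then 1 else 0) \<in> E"
proof -
  have "(\<lambda>u. f (max u v)) \<in> E" for v
    using module[OF delta_in_l1 f(1), of v] by (simp add: left_act_delta)
  then have "(\<lambda>u. 1 / (f s - f t) * (f (max u s) - f (max u t))) \<in> E"
    by (intro lin_subspace_scale lin_subspace_diff lin)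
  \<comment> \<open>For \<open>u \<le> s\<close> the two maxima are \<open>s\<close> and
    \<open>t\<close>; for \<open>t \<le> u\<close> both are \<open>u\<close> and the terms
    cancel.\<close>
  moreover have "1 / (f s - f t) * (f (max u s) - f (max u t)) = (if u \<le> s then 1 else 0)" for u
    using f(2) \<open>s < t\<close> succ[of u] by (auto simp: max_def)
  ultimately show ?thesis by simp
qed

lemma delta_in_predual:
  fixes E :: "(posint \<Rightarrow> complex) set"
  assumes "predual max E"
  shows "delta s \<in> E"
proof -
  have lin: "lin_subspace E" and module: "\<And>a f. a \<in> l1 \<Longrightarrow> f \<in> E \<Longrightarrow> left_act max a f \<in> E"
    and inj: "inj_on (canonical_map E) l1"
    using assms homeomorphic_imp_injective_map[of "norm_topology l1 l1_norm"]
    unfolding predual_def topspace_norm_topology_l1 by blast+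
  define p where "p n = posint_of_nat (Suc n)" for n
  have p [simp]: "nat_of_posint (p n) = Suc n" for n
    by (simp add: p_def posint_of_nat_inverse)
  have p_surj: "\<exists>n. u = p n" for u
    using nat_of_posint[of u] nat_of_posint_inverse[of u]
    by (intro exI[of _ "nat_of_posint u - 1"]) (simp add: p_def)
  have ind: "(\<lambda>u. if u \<le> p n then 1 else 0) \<in> E" for n
  proof -
    have "p n < p (Suc n)"
      by (simp add: less_posint_def)
    then have "delta (p n) \<noteq> delta (p (Suc n))"
      by (metis delta_def order_less_irrefl zero_neq_one)
    \<comment> \<open>Injectivity of the canonical map, applied to two unit vectors, yields a member
      of \<open>E\<close> that separates the two points.\<close>
    then have "canonical_map E (delta (p n)) \<noteq> canonical_map E (delta (p (Suc n)))"
      using inj by (simp add: inj_on_eq_iff delta_in_l1)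
    then obtain f where "f \<in> E" "f (p n) \<noteq> f (p (Suc n))"
      by (auto simp: canonical_map_def pairing_delta fun_eq_iff split: if_splits)
    moreover have "u \<le> p n \<or> p (Suc n) \<le> u" for u
      by (auto simp: less_eq_posint_def)
    ultimately show ?thesis
      using indicator_in_bimodule[OF lin module] \<open>p n < p (Suc n)\<close> by blast
  qed
  obtain n where s: "s = p n" using p_surj by blast
  have eq: "u = p k \<longleftrightarrow> nat_of_posint u = Suc k" for u k
    by (metis p nat_of_posint_inject)
  show ?thesis
  \<comment> \<open>At the least element the indicator is already a unit vector; elsewhere a unit
    vector is the difference of two consecutive indicators.\<close>
  proof (cases n)
    case 0
    have "u \<le> p 0 \<longleftrightarrow> u = p 0" for u
      using nat_of_posint[of u] by (auto simp: less_eq_posint_def eq)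
    then show ?thesis using ind[of 0] s 0 by (simp add: delta_def)
  next
    case (Suc k)
    have "(if u \<le> p (Suc k) then 1 else 0) - (if u \<le> p k then 1 else 0) = delta s u" for u
      by (auto simp: less_eq_posint_def eq delta_def s Suc)
    then show ?thesis
      using lin_subspace_diff[OF lin ind[of "Suc k"] ind[of k]] by simp
  qed
qed

theorem theorem5p2:
  fixes E :: "(posint \<Rightarrow> complex) set"
  assumes "predual max E"
  shows "E = c0"
proof
  have El: "E \<subseteq> linf" and lin: "lin_subspace E" and cl: "closedin (norm_topology linf linf_norm) E"
    and homeo: "homeomorphic_map (norm_topology l1 l1_norm) (norm_topology (dual E) (dual_norm E))
      (canonical_map E)"
    using assms unfolding predual_def by blast+
  have "canonical_map E ` l1 = dual E"
    using homeomorphic_imp_surjective_map[OF homeo]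
      Metric_space.topspace_mtopology[OF Metric_space_dual[OF El lin], folded norm_topology_def]
    by (simp add: topspace_norm_topology_l1)
  then show "E \<subseteq> c0"
    by (intro subspace_with_l1_dual_subset_c0 El lin delta_in_predual assms) simp
  show "c0 \<subseteq> E"
    by (intro closed_subspace_with_deltas_contains_c0 lin cl delta_in_predual assms)
qed

end
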